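(* Let $P=\{x_1,\ldots,x_d\}$ be an arbitrary finite partially ordered set. Then the number of edges (one-dimensional faces) of the order polytope $\mathcal{O}(P)$ is equal to the number of edges of the chain polytope $\mathcal{C}(P)$.
   Context: Let $P=\{x_1,\ldots,x_d\}$ be a finite poset and let $\mathbf{e}_1,\ldots,\mathbf{e}_d$ be the standard unit vectors of $\mathbb{R}^d$. The order polytope $\mathcal{O}(P)\subset\mathbb{R}^d$ is the set of $(a_1,\ldots,a_d)\in\mathbb{R}^d$ with $0\le a_i\le 1$ for all $i$ and $a_i\ge a_j$ whenever $x_i\le x_j$ in $P$. The chain polytope $\mathcal{C}(P)\subset\mathbb{R}^d$ is the set of $(a_1,\ldots,a_d)\in\mathbb{R}^d$ with $a_i\ge 0$ for all $i$ and $a_{i_1}+\cdots+a_{i_k}\le 1$ for every maximal chain $x_{i_1}<\cdots<x_{i_k}$ of $P$. *)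

theory Defs
  imports "HOL-Analysis.Analysis"
begin

text \<open>
  The poset \<open>P = {x\<^sub>1, \<dots>, x\<^sub>d}\<close> is represented by its order relation \<open>r\<close>, transported to the
  index type \<open>'n\<close> (so \<open>d = CARD('n)\<close>): \<open>(i, j) \<in> r\<close> means \<open>x\<^sub>i \<le> x\<^sub>j\<close>.
\<close>

definition maximal_chain :: "'n rel \<Rightarrow> 'n set \<Rightarrow> bool" where
  "maximal_chain r C \<longleftrightarrow> C \<in> Chains r \<and> (\<forall>D \<in> Chains r. C \<subseteq> D \<longrightarrow> D = C)"

text \<open>The coordinates are order-reversing: larger poset elements carry smaller values.\<close>

definition order_polytope :: "'n rel \<Rightarrow> (real ^ 'n::finite) set" where
  "order_polytope r =
     {a. (\<forall>i. 0 \<le> a $ i \<and> a $ i \<le> 1) \<and> (\<forall>i j. (i, j) \<in> r \<longrightarrow> a $ j \<le> a $ i)}"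

definition chain_polytope :: "'n rel \<Rightarrow> (real ^ 'n::finite) set" where
  "chain_polytope r =
     {a. (\<forall>i. 0 \<le> a $ i) \<and> (\<forall>C. maximal_chain r C \<longrightarrow> (\<Sum>i\<in>C. a $ i) \<le> 1)}"

text \<open>
  Both sets are polyhedra, so they have only finitely many edges and counting edges with
  \<open>card\<close> is meaningful.
\<close>

lemma polyhedron_order_polytope: "polyhedron (order_polytope r)"
proof -
  have "order_polytope r =
      \<Inter> ((\<lambda>i. {a. axis i 1 \<bullet> a \<ge> 0} \<inter> {a. axis i 1 \<bullet> a \<le> 1}) ` UNIV \<union>
         (\<lambda>(i, j). {a. (axis j 1 - axis i 1) \<bullet> a \<le> 0}) ` r)"
    by (simp add: order_polytope_def inner_axis' inner_diff_left set_eq_iff ball_Un split_beta)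
      (simp add: Ball_def)
  also have "polyhedron \<dots>"
    by (rule polyhedron_Inter) (auto intro: polyhedron_halfspace_le polyhedron_halfspace_ge)
  finally show ?thesis .
qed

lemma polyhedron_chain_polytope: "polyhedron (chain_polytope r)"
proof -
  have "chain_polytope r =
      \<Inter> ((\<lambda>i. {a. axis i 1 \<bullet> a \<ge> 0}) ` UNIV \<union>
         (\<lambda>C. {a. (\<Sum>i\<in>C. axis i 1) \<bullet> a \<le> 1}) ` {C. maximal_chain r C})"
    by (simp add: chain_polytope_def inner_axis' inner_sum_left set_eq_iff ball_Un)
  also have "polyhedron \<dots>"
    by (rule polyhedron_Inter) (auto intro: polyhedron_halfspace_le polyhedron_halfspace_ge)
  finally show ?thesis .
qed

lemma finite_edges_order_polytope: "finite {e. e edge_of order_polytope r}"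
  by (rule finite_subset[OF _ finite_polyhedron_faces[OF polyhedron_order_polytope]])
    (auto simp: edge_of_def)

lemma finite_edges_chain_polytope: "finite {e. e edge_of chain_polytope r}"
  by (rule finite_subset[OF _ finite_polyhedron_faces[OF polyhedron_chain_polytope]])
    (auto simp: edge_of_def)

end

theory Submission
  imports Defs
begin

text \<open>
  The vertices of the order polytope are the indicators of down-sets, those of the chain polytope
  the indicators of antichains. A segment between two vertices is an edge iff it contains no
  midpoint of two other vertices, which means: \<open>I \<subset> J\<close> with \<open>J - I\<close> connected in the comparability
  graph, respectively \<open>A\<close>, \<open>B\<close> with connected symmetric difference. In the latter case one of
  \<open>A - B\<close>, \<open>B - A\<close> lies below the other. For \<open>Q = J - I\<close> the edge \<open>{I, J}\<close> corresponds to
  \<open>B = max J\<close> and to \<open>A\<close> obtained from \<open>B\<close> by exchanging \<open>max Q\<close> for \<open>min Q\<close> (just deleting the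
  element if \<open>Q\<close> is a singleton), because \<open>Q\<close> is connected iff \<open>min Q \<union> max Q\<close> is; conversely
  \<open>J\<close> is generated by \<open>B\<close>, and \<open>Q\<close> is the union of the intervals from \<open>A - B\<close> to \<open>B - A\<close>.
\<close>

section \<open>Indicator vectors, segments as faces, and extreme points\<close>

definition chi :: "'n set \<Rightarrow> real ^ 'n::finite" where
  "chi A = (\<chi> i. of_bool (i \<in> A))"

lemma chi_nth [simp]: "chi A $ i = of_bool (i \<in> A)"
  by (simp add: chi_def)

lemma chi_eq_iff [simp]: "chi A = chi B \<longleftrightarrow> A = B"
  by (auto simp: vec_eq_iff)

text \<open>Strictly inside the segment, every coordinate in which \<open>A\<close> and
  \<open>B\<close> differ lies strictly between 0 and 1, which no indicator allows.\<close>

lemma chi_in_segment_chi: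
  assumes "chi C \<in> closed_segment (chi A) (chi B)"
  shows "C = A \<or> C = B"
proof -
  obtain u where u: "0 \<le> u" "u \<le> 1" "chi C = (1 - u) *\<^sub>R chi A + u *\<^sub>R chi B"
    using assms by (auto simp: in_segment)
  have C: "of_bool (i \<in> C) = (1 - u) * of_bool (i \<in> A) + u * of_bool (i \<in> B)" for i
    using arg_cong[OF u(3), of "\<lambda>x. x $ i"] by simp
  consider "u = 0" | "u = 1" | "0 < u" "u < 1"
    using u by linarith
  then show ?thesis
  proof cases
    case 3
    have "(i \<in> C) = (i \<in> A)" for i
      using C[of i] 3 by (cases "i \<in> A"; cases "i \<in> B"; cases "i \<in> C") auto
    then show ?thesis by auto
  qed (use u(3) in auto)
qed

text \<open>Both pairs have the same midpoint, so the face contains an inner point of the segment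
  from \<open>chi C\<close> to \<open>chi D\<close> and hence its ends. Redistributing elements
  between \<open>A\<close> and \<open>B\<close> in this way yields the necessary conditions for
  edges.\<close>

lemma face_exchange:
  assumes face: "closed_segment (chi A) (chi B) face_of S"
    and CD: "chi C \<in> S" "chi D \<in> S" and sum: "chi C + chi D = chi A + chi B"
  shows "C = A \<or> C = B"
proof -
  have mid: "midpoint (chi C) (chi D) \<in> closed_segment (chi A) (chi B)"
  proof -
    have "midpoint (chi C) (chi D) = midpoint (chi A) (chi B)"
      using sum by (simp add: midpoint_def)
    then show ?thesis by simp
  qed
  have "chi C \<in> closed_segment (chi A) (chi B)"
  proof (cases "C = D")
    case False
    then have "midpoint (chi C) (chi D) \<in> open_segment (chi C) (chi D)"
      by simp
    then show ?thesis
      using face_ofD[OF face _ CD mid] by blast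
  qed (use mid in auto)
  then show ?thesis
    by (rule chi_in_segment_chi)
qed

text \<open>Replacing \<open>t\<close> by \<open>1 - t\<close> exchanges \<open>u\<close> and
  \<open>v\<close>, so the premise about \<open>u\<close> alone covers both ends.\<close>

lemma closed_segment_face_ofI:
  assumes "convex S" "a \<in> S" "b \<in> S"
    and *: "\<And>x u v t. \<lbrakk>x \<in> closed_segment a b; u \<in> S; v \<in> S; 0 < t; t < 1;
                x = (1 - t) *\<^sub>R u + t *\<^sub>R v\<rbrakk> \<Longrightarrow> u \<in> closed_segment a b"
  shows "closed_segment a b face_of S"
  unfolding face_of_def
proof (intro conjI ballI impI)
  show "closed_segment a b \<subseteq> S"
    using assms closed_segment_subset by blast
next
  fix u v x assume uv: "u \<in> S" "v \<in> S" "x \<in> closed_segment a b" "x \<in> open_segment u v"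
  show "u \<in> closed_segment a b"
    using uv * unfolding in_segment(2) by blast
  have "x \<in> open_segment v u"
    using uv(4) by (simp add: open_segment_commute)
  then show "v \<in> closed_segment a b"
    using uv * unfolding in_segment(2) by blast
qed auto

text \<open>A face of a compact convex set is compact and convex; dimension 1 makes it collinear,
  hence a segment.\<close>

lemma edge_of_compact_iff:
  fixes S :: "'a::euclidean_space set"
  assumes "compact S" "convex S"
  shows "e edge_of S \<longleftrightarrow> (\<exists>a b. a \<noteq> b \<and> e = closed_segment a b \<and> e face_of S)"
proof
  assume e: "e edge_of S"
  then have face: "e face_of S" and dim: "aff_dim e = 1"
    by (auto simp: edge_of_def)
  have "collinear e" "e \<noteq> {}"
    using dim by (auto simp: collinear_aff_dim)
  then obtain a b where ab: "e = closed_segment a b"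
    using compact_convex_collinear_segment face_of_imp_compact[OF \<open>convex S\<close> \<open>compact S\<close> face]
      face_of_imp_convex[OF face] by blast
  with dim have "a \<noteq> b"
    by auto
  with ab face show "\<exists>a b. a \<noteq> b \<and> e = closed_segment a b \<and> e face_of S"
    by blast
next
  assume "\<exists>a b. a \<noteq> b \<and> e = closed_segment a b \<and> e face_of S"
  then show "e edge_of S"
    by (auto simp: edge_of_def segment_convex_hull aff_dim_convex_hull)
qed

lemma extreme_point_ofD_sum:
  assumes "a extreme_point_of S" "b \<in> S" "c \<in> S" "b + c = a + a"
  shows "b = a"
proof (rule ccontr)
  assume "b \<noteq> a"
  then have "b \<noteq> c"
    using assms(4) by (metis scaleR_2 scaleR_left_imp_eq zero_neq_numeral)
  moreover have "midpoint b c = a"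
    using assms(4) by (simp add: midpoint_def flip: scaleR_2)
  ultimately have "a \<in> open_segment b c"
    by (metis midpoint_in_open_segment)
  with assms show False
    by (auto simp: extreme_point_of_def)
qed

text \<open>The two deficits \<open>c - p\<close> and \<open>c - q\<close> are nonnegative with
  vanishing weighted sum. This passes a tight inequality from an inner point of a segment to an end
  of it.\<close>

lemma convex_combination_eq_upper:
  fixes p q c t :: real
  assumes "0 < t" "t < 1" "p \<le> c" "q \<le> c" "(1 - t) * p + t * q = c"
  shows "p = c"
proof -
  have "(1 - t) * (c - p) + t * (c - q) = 0"
    using assms(5) by (simp add: algebra_simps)
  moreover have "(1 - t) * (c - p) \<ge> 0" "t * (c - q) \<ge> 0"
    using assms by auto
  ultimately have "(1 - t) * (c - p) = 0"
    by linarith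
  then show ?thesis
    using assms by simp
qed

lemma convex_combination_eq_lower:
  fixes p q c t :: real
  assumes "0 < t" "t < 1" "c \<le> p" "c \<le> q" "(1 - t) * p + t * q = c"
  shows "p = c"
  using convex_combination_eq_upper[of t "- p" "- c" "- q"] assms by simp

section \<open>Extremal elements and connectedness in a finite poset\<close>

locale finite_poset =
  fixes r :: "'n::finite rel"
  assumes partial_order: "partial_order_on UNIV r"
begin

abbreviation le :: "'n \<Rightarrow> 'n \<Rightarrow> bool" (infix "\<sqsubseteq>" 50) where
  "x \<sqsubseteq> y \<equiv> (x, y) \<in> r"

lemma le_refl [simp]: "x \<sqsubseteq> x"
  using partial_order by (auto simp: partial_order_on_def preorder_on_def refl_on_def)

lemma le_antisym: "x \<sqsubseteq> y \<Longrightarrow> y \<sqsubseteq> x \<Longrightarrow> x = y"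
  using partial_order by (auto simp: partial_order_on_def antisym_def)

lemma le_trans: "x \<sqsubseteq> y \<Longrightarrow> y \<sqsubseteq> z \<Longrightarrow> x \<sqsubseteq> z"
  using partial_order by (auto simp: partial_order_on_def preorder_on_def elim: transE)

definition maximals :: "'n set \<Rightarrow> 'n set" where
  "maximals Q = {x \<in> Q. \<forall>y\<in>Q. x \<sqsubseteq> y \<longrightarrow> y = x}"

definition minimals :: "'n set \<Rightarrow> 'n set" where
  "minimals Q = {x \<in> Q. \<forall>y\<in>Q. y \<sqsubseteq> x \<longrightarrow> y = x}"

definition down_set :: "'n set \<Rightarrow> bool" where
  "down_set I \<longleftrightarrow> (\<forall>x\<in>I. \<forall>y. y \<sqsubseteq> x \<longrightarrow> y \<in> I)"

definition antichain :: "'n set \<Rightarrow> bool" where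
  "antichain A \<longleftrightarrow> (\<forall>x\<in>A. \<forall>y\<in>A. x \<sqsubseteq> y \<longrightarrow> x = y)"

text \<open>Connectedness of the comparability graph induced on \<open>Q\<close>, phrased by cuts
  instead of paths because a cut that no comparability crosses is exactly what permits an exchange
  between two vertices.\<close>

definition connected_in :: "'n set \<Rightarrow> bool" where
  "connected_in Q \<longleftrightarrow> Q \<noteq> {} \<and>
     (\<forall>X\<subseteq>Q. X \<noteq> {} \<longrightarrow> X \<noteq> Q \<longrightarrow> (\<exists>x\<in>X. \<exists>y\<in>Q - X. x \<sqsubseteq> y \<or> y \<sqsubseteq> x))"

lemma ex_maximal_above:
  assumes "x \<in> Q"
  obtains m where "m \<in> maximals Q" "x \<sqsubseteq> m"
proof -
  let ?S = "{y \<in> Q. x \<sqsubseteq> y}"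
  have "\<exists>m\<in>?S. \<forall>y\<in>?S. y \<noteq> m \<longrightarrow> \<not> (m \<sqsubseteq> y \<and> m \<noteq> y)"
    by (rule Finite_Set.bex_max_element)
      (use assms in \<open>auto simp: transp_on_def asymp_on_def intro: le_trans dest: le_antisym\<close>)
  then obtain m where "m \<in> Q" "x \<sqsubseteq> m" "\<And>y. y \<in> Q \<Longrightarrow> x \<sqsubseteq> y \<Longrightarrow> m \<sqsubseteq> y \<Longrightarrow> y = m"
    by blast
  then show thesis
    using that[of m] le_trans unfolding maximals_def by blast
qed

lemma ex_minimal_below:
  assumes "x \<in> Q"
  obtains m where "m \<in> minimals Q" "m \<sqsubseteq> x"
proof -
  let ?S = "{y \<in> Q. y \<sqsubseteq> x}"
  have "\<exists>m\<in>?S. \<forall>y\<in>?S. y \<noteq> m \<longrightarrow> \<not> (y \<sqsubseteq> m \<and> m \<noteq> y)"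
    by (rule Finite_Set.bex_min_element)
      (use assms in \<open>auto simp: transp_on_def asymp_on_def intro: le_trans dest: le_antisym\<close>)
  then obtain m where "m \<in> Q" "m \<sqsubseteq> x" "\<And>y. y \<in> Q \<Longrightarrow> y \<sqsubseteq> x \<Longrightarrow> y \<sqsubseteq> m \<Longrightarrow> y = m"
    by blast
  then show thesis
    using that[of m] le_trans unfolding minimals_def by blast
qed

text \<open>No comparability leaves a level set of \<open>f\<close>, so a nonempty level set is all
  of \<open>Q\<close>.\<close>

lemma connected_in_const:
  assumes Q: "connected_in Q" and f: "\<And>x y. x \<in> Q \<Longrightarrow> y \<in> Q \<Longrightarrow> x \<sqsubseteq> y \<Longrightarrow> f x = f y"
  shows "\<exists>q\<in>Q. \<forall>x\<in>Q. f x = f q"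
proof -
  obtain q where q: "q \<in> Q"
    using Q by (auto simp: connected_in_def)
  let ?X = "{x \<in> Q. f x = f q}"
  have "?X = Q"
  proof (rule ccontr)
    assume "?X \<noteq> Q"
    moreover have "?X \<subseteq> Q" "?X \<noteq> {}"
      using q by auto
    ultimately have "\<exists>x\<in>?X. \<exists>y\<in>Q - ?X. x \<sqsubseteq> y \<or> y \<sqsubseteq> x"
      using Q unfolding connected_in_def by blast
    then obtain x y where "x \<in> Q" "f x = f q" "y \<in> Q" "f y \<noteq> f q" "x \<sqsubseteq> y \<or> y \<sqsubseteq> x"
      by blast
    then show False
      using f[of x y] f[of y x] by auto
  qed
  with q show ?thesis by blast
qed

text \<open>If no comparability crosses a cut of \<open>Q\<close>, each element lies on the side of
  the maximal elements above it, so the cut restricts to one of the extremal elements. Conversely,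
  an uncrossed cut of the extremal elements extends to \<open>Q\<close> through the predicate
  \<open>f\<close>.\<close>

lemma connected_in_extremals_iff:
  "connected_in (minimals Q \<union> maximals Q) \<longleftrightarrow> connected_in Q" (is "connected_in ?E \<longleftrightarrow> _")
proof
  assume E: "connected_in ?E"
  show "connected_in Q"
    unfolding connected_in_def
  proof (intro conjI allI impI)
    show "Q \<noteq> {}"
      using E by (auto simp: connected_in_def minimals_def maximals_def)
    fix X assume X: "X \<subseteq> Q" "X \<noteq> {}" "X \<noteq> Q"
    show "\<exists>x\<in>X. \<exists>y\<in>Q - X. x \<sqsubseteq> y \<or> y \<sqsubseteq> x"
    proof (rule ccontr)
      assume neg: "\<not> ?thesis"
      have EQ: "?E \<subseteq> Q"
        by (auto simp: minimals_def maximals_def)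
      obtain x where x: "x \<in> X" using X by auto
      then obtain m where m: "m \<in> maximals Q" "x \<sqsubseteq> m"
        using ex_maximal_above X by blast
      have mX: "m \<in> X"
        using neg x m EQ by blast
      obtain y where y: "y \<in> Q - X" using X by auto
      then obtain n where n: "n \<in> maximals Q" "y \<sqsubseteq> n"
        using ex_maximal_above X by blast
      have nX: "n \<notin> X"
        using neg y n EQ by blast
      have "X \<inter> ?E \<subseteq> ?E" "X \<inter> ?E \<noteq> {}" "X \<inter> ?E \<noteq> ?E"
        using m n mX nX by auto
      then have "\<exists>x\<in>X \<inter> ?E. \<exists>y\<in>?E - X \<inter> ?E. x \<sqsubseteq> y \<or> y \<sqsubseteq> x"
        using E unfolding connected_in_def by blast
      then show False
        using neg EQ by blast
    qed
  qed
next
  assume Q: "connected_in Q"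
  have EQ: "?E \<subseteq> Q"
    by (auto simp: minimals_def maximals_def)
  show "connected_in ?E"
    unfolding connected_in_def
  proof (intro conjI allI impI)
    obtain x where "x \<in> Q"
      using Q by (auto simp: connected_in_def)
    then obtain m where "m \<in> maximals Q"
      by (rule ex_maximal_above)
    then show "?E \<noteq> {}"
      by blast
    fix X assume X: "X \<subseteq> ?E" "X \<noteq> {}" "X \<noteq> ?E"
    show "\<exists>x\<in>X. \<exists>y\<in>?E - X. x \<sqsubseteq> y \<or> y \<sqsubseteq> x"
    proof (rule ccontr)
      assume neg: "\<not> ?thesis"
      have same: "a \<in> X \<longleftrightarrow> b \<in> X" if "a \<in> ?E" "b \<in> ?E" "a \<sqsubseteq> b" for a b
        using neg that by blast
      define f where "f x \<longleftrightarrow> (\<exists>m\<in>minimals Q. m \<sqsubseteq> x \<and> m \<in> X)" for x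
      \<comment> \<open>All minimal elements below \<open>x\<close> lie below one maximal element
        above \<open>x\<close>, hence on one side of the cut; so any of them decides
        \<open>f x\<close>.\<close>
      have f_min: "f x \<longleftrightarrow> m \<in> X" if x: "x \<in> Q" and m: "m \<in> minimals Q" "m \<sqsubseteq> x" for x m
      proof -
        obtain n where n: "n \<in> maximals Q" "x \<sqsubseteq> n"
          using ex_maximal_above x by blast
        have "m' \<in> X \<longleftrightarrow> n \<in> X" if "m' \<in> minimals Q" "m' \<sqsubseteq> x" for m'
          using same[of m' n] that n le_trans by blast
        then show ?thesis
          using m unfolding f_def by blast
      qed
      have f_E: "f x \<longleftrightarrow> x \<in> X" if "x \<in> ?E" for x
      proof -
        obtain m where m: "m \<in> minimals Q" "m \<sqsubseteq> x"
          using ex_minimal_below EQ \<open>x \<in> ?E\<close> by blast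
        then show ?thesis
          using f_min[of x m] same[of m x] that EQ by blast
      qed
      have "f x = f y" if xy: "x \<in> Q" "y \<in> Q" "x \<sqsubseteq> y" for x y
      proof -
        obtain m where "m \<in> minimals Q" "m \<sqsubseteq> x"
          using ex_minimal_below xy by blast
        then show ?thesis
          using f_min[of x m] f_min[of y m] xy le_trans by blast
      qed
      then obtain q where q: "\<And>x. x \<in> Q \<Longrightarrow> f x = f q"
        using connected_in_const[OF Q, of f] by blast
      obtain x y where "x \<in> X" "y \<in> ?E - X"
        using X by auto
      then show False
        using f_E[of x] f_E[of y] q[of x] q[of y] X EQ by blast
    qed
  qed
qed

subsection \<open>Edges of the order polytope\<close>

lemma convex_order_polytope: "convex (order_polytope r)"
  using polyhedron_order_polytope by (rule polyhedron_imp_convex)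

lemma compact_order_polytope: "compact (order_polytope r)"
proof -
  have "order_polytope r \<subseteq> cbox 0 1"
    by (auto simp: order_polytope_def mem_box_cart)
  then have "bounded (order_polytope r)"
    using bounded_cbox bounded_subset by blast
  then show ?thesis
    using polyhedron_imp_closed[OF polyhedron_order_polytope] by (simp add: compact_eq_bounded_closed)
qed

lemma chi_in_order_polytope_iff: "chi I \<in> order_polytope r \<longleftrightarrow> down_set I"
  by (auto simp: order_polytope_def down_set_def)

text \<open>A point is the average of its images under the monotone maps \<open>t\<^sup>2\<close> and \<open>2 t - t\<^sup>2\<close>, which fix
  only the coordinates 0 and 1.\<close>
lemma extreme_point_of_order_polytope:
  assumes a: "a extreme_point_of order_polytope r"
  obtains I where "a = chi I" "down_set I"
proof -
  have a01: "0 \<le> a $ i" "a $ i \<le> 1" and dec: "i \<sqsubseteq> j \<Longrightarrow> a $ j \<le> a $ i" for i j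
    using a by (auto simp: extreme_point_of_def order_polytope_def)
  define b c :: "real ^ 'n" where "b = (\<chi> i. (a $ i)\<^sup>2)" and "c = (\<chi> i. 1 - (1 - a $ i)\<^sup>2)"
  have "b \<in> order_polytope r"
    using a01 dec by (auto simp: order_polytope_def b_def power_le_one intro: power_mono)
  moreover have "c \<in> order_polytope r"
    using a01 dec by (auto simp: order_polytope_def c_def power_le_one intro: power_mono)
  moreover have "b + c = a + a"
    by (simp add: b_def c_def vec_eq_iff power2_eq_square algebra_simps)
  ultimately have "b = a"
    using extreme_point_ofD_sum[OF a] by blast
  then have "(a $ i)\<^sup>2 = a $ i" for i
    by (auto simp: b_def vec_eq_iff)
  then have "a $ i = 0 \<or> a $ i = 1" for i
    by (simp add: power2_eq_square)
  then have "a = chi {i. a $ i = 1}"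
    by (auto simp: vec_eq_iff)
  moreover have "down_set {i. a $ i = 1}"
    using a01 dec by (force simp: down_set_def intro: antisym)
  ultimately show thesis
    using that by blast
qed

text \<open>Inclusion orients the pair, so every edge is represented only once.\<close>

definition order_edges :: "('n set \<times> 'n set) set" where
  "order_edges = {(I, J). down_set I \<and> down_set J \<and> I \<subset> J \<and> connected_in (J - I)}"

text \<open>On the whole segment the inequalities \<open>a $ i \<le> 1\<close> for \<open>i\<close>
  in \<open>I\<close>, \<open>0 \<le> a $ i\<close> for \<open>i\<close> outside \<open>J\<close>,
  and \<open>a $ j \<le> a $ i\<close> for \<open>i \<sqsubseteq> j\<close> in \<open>J - I\<close>
  are tight. They stay tight at \<open>u\<close>, and connectedness leaves one common value on
  \<open>J - I\<close>.\<close>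

lemma segment_face_of_order_polytope:
  assumes "(I, J) \<in> order_edges"
  shows "closed_segment (chi I) (chi J) face_of order_polytope r"
proof (rule closed_segment_face_ofI)
  have IJ: "down_set I" "down_set J" "I \<subset> J" and conn: "connected_in (J - I)"
    using assms by (auto simp: order_edges_def)
  show "chi I \<in> order_polytope r" "chi J \<in> order_polytope r"
    using IJ by (auto simp: chi_in_order_polytope_iff)
  fix x u v t
  assume x: "x \<in> closed_segment (chi I) (chi J)" and u: "u \<in> order_polytope r"
    and v: "v \<in> order_polytope r" and t: "0 < t" "t < (1::real)" "x = (1 - t) *\<^sub>R u + t *\<^sub>R v"
  obtain s where s: "x = (1 - s) *\<^sub>R chi I + s *\<^sub>R chi J"
    using x by (auto simp: in_segment)
  have xs: "(1 - t) * u $ i + t * v $ i = (1 - s) * of_bool (i \<in> I) + s * of_bool (i \<in> J)" for i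
    using arg_cong[OF trans[OF t(3)[symmetric] s], of "\<lambda>x. x $ i"] by simp
  have uv: "0 \<le> u $ i" "u $ i \<le> 1" "0 \<le> v $ i" "v $ i \<le> 1"
    "i \<sqsubseteq> j \<Longrightarrow> u $ j \<le> u $ i" "i \<sqsubseteq> j \<Longrightarrow> v $ j \<le> v $ i" for i j
    using u v by (auto simp: order_polytope_def)
  have uI: "u $ i = 1" if "i \<in> I" for i
    by (rule convex_combination_eq_upper[OF t(1,2), of _ _ "v $ i"])
      (use xs[of i] uv that IJ in auto)
  have uJ: "u $ i = 0" if "i \<notin> J" for i
    by (rule convex_combination_eq_lower[OF t(1,2), of _ _ "v $ i"])
      (use xs[of i] uv that IJ in auto)
  have "u $ i = u $ j" if "i \<in> J - I" "j \<in> J - I" "i \<sqsubseteq> j" for i j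
  proof -
    have "u $ i - u $ j = 0"
    proof (rule convex_combination_eq_lower[OF t(1,2), of _ _ "v $ i - v $ j"])
      show "(1 - t) * (u $ i - u $ j) + t * (v $ i - v $ j) = 0"
        using xs[of i] xs[of j] that by (simp add: algebra_simps)
    qed (use uv that in auto)
    then show ?thesis by simp
  qed
  then obtain q where q: "q \<in> J - I" "\<And>i. i \<in> J - I \<Longrightarrow> u $ i = u $ q"
    using connected_in_const[OF conn, of "\<lambda>i. u $ i"] by blast
  \<comment> \<open>The common value on \<open>J - I\<close> is the parameter of \<open>u\<close> on
    the segment.\<close>
  define c where "c = u $ q"
  have "u $ i = (1 - c) * of_bool (i \<in> I) + c * of_bool (i \<in> J)" for i
    using uI[of i] uJ[of i] q(2)[of i] IJ by (auto simp: c_def)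
  then have "u = (1 - c) *\<^sub>R chi I + c *\<^sub>R chi J"
    by (simp add: vec_eq_iff)
  then show "u \<in> closed_segment (chi I) (chi J)"
    using uv(1,2)[of q] by (auto simp: in_segment c_def)
qed (rule convex_order_polytope)

text \<open>Exchanging with \<open>I \<inter> J\<close> and \<open>I \<union> J\<close> forces the
  two down-sets to be nested; an uncrossed cut \<open>X\<close> of the difference would allow the
  exchange with \<open>I \<union> X\<close> and \<open>J - X\<close>.\<close>

lemma order_edge_of_face:
  assumes face: "closed_segment (chi I) (chi J) face_of order_polytope r"
    and "I \<noteq> J" and I: "down_set I" and J: "down_set J"
  shows "(I, J) \<in> order_edges \<or> (J, I) \<in> order_edges"
proof -
  have exch: "C = I \<or> C = J" if "down_set C" "down_set D" "chi C + chi D = chi I + chi J" for C D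
    using face_exchange[OF face] that by (auto simp: chi_in_order_polytope_iff)
  have inter: "I \<inter> J = I \<or> I \<inter> J = J"
    by (rule exch[of _ "I \<union> J"]) (use I J in \<open>auto simp: down_set_def vec_eq_iff\<close>)
  \<comment> \<open>Stated for renamed sets so that it serves both possible inclusions.\<close>
  have conn: "connected_in (J' - I')"
    if IJ: "I' \<subset> J'" "{I', J'} = {I, J}" for I' J'
    unfolding connected_in_def
  proof (intro conjI allI impI)
    fix X assume X: "X \<subseteq> J' - I'" "X \<noteq> {}" "X \<noteq> J' - I'"
    show "\<exists>x\<in>X. \<exists>y\<in>J' - I' - X. x \<sqsubseteq> y \<or> y \<sqsubseteq> x"
    proof (rule ccontr)
      assume neg: "\<not> ?thesis"
      have down: "down_set I'" "down_set J'"
        using IJ I J by (auto simp: doubleton_eq_iff)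
      have "down_set (I' \<union> X)" "down_set (J' - X)"
        using down neg X IJ unfolding down_set_def by blast+
      moreover have "chi (I' \<union> X) + chi (J' - X) = chi I' + chi J'"
        using X IJ by (auto simp: vec_eq_iff of_bool_def)
      moreover have "chi I' + chi J' = chi I + chi J"
        using IJ by (auto simp: doubleton_eq_iff add.commute)
      ultimately have "I' \<union> X = I' \<or> I' \<union> X = J'"
        using exch IJ by (metis doubleton_eq_iff)
      then show False
        using X IJ by auto
    qed
  qed (use IJ in auto)
  consider "I \<subset> J" | "J \<subset> I"
    using inter \<open>I \<noteq> J\<close> by blast
  then show ?thesis
  proof cases
    case 1
    then show ?thesis
      using conn[of I J] I J by (simp add: order_edges_def)
  next
    case 2
    then show ?thesis
      using conn[of J I] I J by (simp add: order_edges_def insert_commute)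
  qed
qed

text \<open>A segment determines its unordered pair of ends, and inclusion orders them. For
  surjectivity, the ends of a segment that is a face are extreme points, hence indicators of
  down-sets.\<close>

lemma bij_betw_order_edges:
  "bij_betw (\<lambda>(I, J). closed_segment (chi I) (chi J)) order_edges {e. e edge_of order_polytope r}"
  unfolding bij_betw_def
proof
  show "inj_on (\<lambda>(I, J). closed_segment (chi I) (chi J)) order_edges"
    by (auto simp: inj_on_def order_edges_def doubleton_eq_iff)
  show "(\<lambda>(I, J). closed_segment (chi I) (chi J)) ` order_edges = {e. e edge_of order_polytope r}"
  proof (intro equalityI subsetI)
    fix e assume "e \<in> (\<lambda>(I, J). closed_segment (chi I) (chi J)) ` order_edges"
    then obtain I J where e: "e = closed_segment (chi I) (chi J)" and IJ: "(I, J) \<in> order_edges"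
      by auto
    then have "I \<noteq> J"
      by (auto simp: order_edges_def)
    then show "e \<in> {e. e edge_of order_polytope r}"
      using segment_face_of_order_polytope[OF IJ] e
        edge_of_compact_iff[OF compact_order_polytope convex_order_polytope]
      by (metis chi_eq_iff mem_Collect_eq)
  next
    fix e assume "e \<in> {e. e edge_of order_polytope r}"
    then obtain a b where ab: "a \<noteq> b" "e = closed_segment a b" "e face_of order_polytope r"
      using edge_of_compact_iff[OF compact_order_polytope convex_order_polytope] by auto
    obtain I where I: "a = chi I" "down_set I"
      using extreme_point_of_order_polytope segment_face_of(1)  ab by metis
    obtain J where J: "b = chi J" "down_set J"
      using extreme_point_of_order_polytope segment_face_of(2) ab by metis
    have "(I, J) \<in> order_edges \<or> (J, I) \<in> order_edges"
      by (rule order_edge_of_face) (use ab I J in auto)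
    then show "e \<in> (\<lambda>(I, J). closed_segment (chi I) (chi J)) ` order_edges"
    proof
      assume "(I, J) \<in> order_edges"
      then show ?thesis
        by (rule rev_image_eqI) (simp add: ab I J)
    next
      assume "(J, I) \<in> order_edges"
      then show ?thesis
        by (rule rev_image_eqI) (simp add: ab I J insert_commute)
    qed
  qed
qed

subsection \<open>Edges of the chain polytope\<close>

lemma in_Chains_iff: "C \<in> Chains r \<longleftrightarrow> (\<forall>x\<in>C. \<forall>y\<in>C. x \<sqsubseteq> y \<or> y \<sqsubseteq> x)"
  by (auto simp: Chains_def)

lemma ex_maximal_chain:
  assumes "C \<in> Chains r"
  obtains D where "maximal_chain r D" "C \<subseteq> D"
proof -
  have "finite (Chains r)"
    by simp
  then obtain D where "D \<in> Chains r" "C \<subseteq> D" "\<And>E. E \<in> Chains r \<Longrightarrow> D \<subseteq> E \<Longrightarrow> D = E"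
    using finite_has_maximal2[of "Chains r" C] assms by blast
  then show thesis
    using that[of D] unfolding maximal_chain_def by blast
qed

text \<open>Coordinates are nonnegative, so enlarging a chain to a maximal one does not decrease its
  sum. Short chains then give bounds on single coordinates and comparable pairs.\<close>

lemma in_chain_polytope_iff:
  "a \<in> chain_polytope r \<longleftrightarrow> (\<forall>i. 0 \<le> a $ i) \<and> (\<forall>C\<in>Chains r. (\<Sum>i\<in>C. a $ i) \<le> 1)"
proof -
  have "(\<Sum>i\<in>C. a $ i) \<le> 1"
    if *: "\<forall>i. 0 \<le> a $ i" "\<forall>C. maximal_chain r C \<longrightarrow> (\<Sum>i\<in>C. a $ i) \<le> 1"
      and C: "C \<in> Chains r" for C
  proof -
    obtain D where D: "maximal_chain r D" "C \<subseteq> D"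
      using ex_maximal_chain[OF C] .
    have "(\<Sum>i\<in>C. a $ i) \<le> (\<Sum>i\<in>D. a $ i)"
      by (rule sum_mono2) (use D * in auto)
    then show ?thesis
      using * D by force
  qed
  then show ?thesis
    by (auto simp: chain_polytope_def maximal_chain_def)
qed

lemma chain_polytope_le_1:
  assumes "a \<in> chain_polytope r"
  shows "a $ i \<le> 1"
proof -
  have "{i} \<in> Chains r"
    by (simp add: in_Chains_iff)
  then show ?thesis
    using assms unfolding in_chain_polytope_iff by fastforce
qed

lemma chain_polytope_pair_le_1:
  assumes "a \<in> chain_polytope r" "i \<sqsubseteq> j" "i \<noteq> j"
  shows "a $ i + a $ j \<le> 1"
proof -
  have "{i, j} \<in> Chains r"
    using assms by (auto simp: in_Chains_iff)
  then have "(\<Sum>k\<in>{i, j}. a $ k) \<le> 1"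
    using assms unfolding in_chain_polytope_iff by blast
  then show ?thesis
    using assms by simp
qed

lemma convex_chain_polytope: "convex (chain_polytope r)"
  using polyhedron_chain_polytope by (rule polyhedron_imp_convex)

lemma compact_chain_polytope: "compact (chain_polytope r)"
proof -
  have "chain_polytope r \<subseteq> cbox 0 1"
    using chain_polytope_le_1 by (auto simp: in_chain_polytope_iff mem_box_cart)
  then have "bounded (chain_polytope r)"
    using bounded_cbox bounded_subset by blast
  then show ?thesis
    using polyhedron_imp_closed[OF polyhedron_chain_polytope] by (simp add: compact_eq_bounded_closed)
qed

lemma chi_in_chain_polytope_iff: "chi A \<in> chain_polytope r \<longleftrightarrow> antichain A"
proof
  assume A: "chi A \<in> chain_polytope r"
  show "antichain A"
    using chain_polytope_pair_le_1[OF A] by (force simp: antichain_def)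
next
  assume A: "antichain A"
  have "(\<Sum>i\<in>C. chi A $ i) \<le> 1" if C: "C \<in> Chains r" for C
  proof -
    have "x = y" if "x \<in> C \<inter> A" "y \<in> C \<inter> A" for x y
      using that C A by (auto simp: in_Chains_iff antichain_def)
    then have "card (C \<inter> A) \<le> 1"
      by (metis card_le_Suc0_iff_eq finite One_nat_def)
    then show ?thesis
      by (simp add: of_bool_def sum.If_cases)
  qed
  then show "chi A \<in> chain_polytope r"
    by (simp add: in_chain_polytope_iff)
qed

section \<open>Heights of chains and the vertices of the chain polytope\<close>

lemma chain_has_top:
  assumes "C \<in> Chains r" "C \<noteq> {}"
  obtains m where "m \<in> C" "\<And>x. x \<in> C \<Longrightarrow> x \<sqsubseteq> m"
proof -
  obtain m where m: "m \<in> maximals C"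
    using assms(2) ex_maximal_above by blast
  then have "x \<sqsubseteq> m" if "x \<in> C" for x
    using assms(1) that unfolding maximals_def in_Chains_iff by fastforce
  with m that show thesis
    by (auto simp: maximals_def)
qed

definition height :: "real ^ 'n \<Rightarrow> 'n set \<Rightarrow> real" where
  "height a U = Max ((\<lambda>C. \<Sum>i\<in>C. a $ i) ` {C \<in> Chains r. C \<subseteq> U})"

lemma height_ge:
  assumes "C \<in> Chains r" "C \<subseteq> U"
  shows "(\<Sum>i\<in>C. a $ i) \<le> height a U"
  unfolding height_def by (rule Max_ge) (use assms in auto)

lemma height_attained:
  obtains C where "C \<in> Chains r" "C \<subseteq> U" "height a U = (\<Sum>i\<in>C. a $ i)"
proof -
  have "height a U \<in> (\<lambda>C. \<Sum>i\<in>C. a $ i) ` {C \<in> Chains r. C \<subseteq> U}"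
    unfolding height_def by (rule Max_in) (auto simp: in_Chains_iff intro: exI[of _ "{}"])
  with that show thesis by blast
qed

lemma height_mono: "U \<subseteq> V \<Longrightarrow> height a U \<le> height a V"
  by (metis height_attained height_ge order_trans)

lemma height_nonneg: "0 \<le> height a U"
  using height_ge[of "{}" U a] by (simp add: in_Chains_iff)

lemma height_le_1: "a \<in> chain_polytope r \<Longrightarrow> height a U \<le> 1"
  by (metis height_attained in_chain_polytope_iff)

abbreviation below :: "'n \<Rightarrow> 'n set" where "below i \<equiv> {j. j \<sqsubseteq> i}"

abbreviation strictly_below :: "'n \<Rightarrow> 'n set" where "strictly_below i \<equiv> {j. j \<sqsubseteq> i \<and> j \<noteq> i}"

text \<open>The element \<open>i\<close> can be put on top of any chain strictly below it, and
  removing it costs at most \<open>a $ i\<close>. Hence the heights determine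
  \<open>a\<close>.\<close>

lemma height_below:
  assumes "a \<in> chain_polytope r"
  shows "height a (below i) = height a (strictly_below i) + a $ i"
proof (rule antisym)
  obtain C where C: "C \<in> Chains r" "C \<subseteq> below i" "height a (below i) = (\<Sum>i\<in>C. a $ i)"
    by (rule height_attained)
  have "(\<Sum>i\<in>C. a $ i) \<le> (\<Sum>i\<in>insert i (C - {i}). a $ i)"
    by (rule sum_mono2) (use assms in \<open>auto simp: in_chain_polytope_iff\<close>)
  also have "\<dots> = (\<Sum>i\<in>C - {i}. a $ i) + a $ i"
    by (subst sum.insert) auto
  also have "(\<Sum>i\<in>C - {i}. a $ i) \<le> height a (strictly_below i)"
    by (rule height_ge) (use C in \<open>auto simp: in_Chains_iff\<close>)
  finally show "height a (below i) \<le> height a (strictly_below i) + a $ i"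
    using C by simp
next
  obtain C where C: "C \<in> Chains r" "C \<subseteq> strictly_below i"
      "height a (strictly_below i) = (\<Sum>i\<in>C. a $ i)"
    by (rule height_attained)
  have "i \<notin> C"
    using C by auto
  then have "height a (strictly_below i) + a $ i = (\<Sum>j\<in>insert i C. a $ j)"
    using C by simp
  also have "\<dots> \<le> height a (below i)"
    by (rule height_ge) (use C in \<open>auto simp: in_Chains_iff\<close>)
  finally show "height a (strictly_below i) + a $ i \<le> height a (below i)" .
qed

text \<open>The top \<open>j\<close> of a heaviest chain serves as witness; this lets values of
  heights propagate upwards from the minimal elements.\<close>

lemma height_strictly_below:
  "height a (strictly_below i) = 0 \<or>
   (\<exists>j\<in>strictly_below i. height a (strictly_below i) = height a (below j))"
proof -
  obtain C where C: "C \<in> Chains r" "C \<subseteq> strictly_below i"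
      "height a (strictly_below i) = (\<Sum>i\<in>C. a $ i)"
    by (rule height_attained)
  show ?thesis
  proof (cases "C = {}")
    case False
    then obtain j where j: "j \<in> C" "\<And>x. x \<in> C \<Longrightarrow> x \<sqsubseteq> j"
      using chain_has_top C by blast
    have "height a (strictly_below i) \<le> height a (below j)"
      unfolding C(3) by (rule height_ge) (use C j in auto)
    moreover have "height a (below j) \<le> height a (strictly_below i)"
      by (rule height_mono) (use C j in \<open>auto intro: le_trans dest: le_antisym\<close>)
    ultimately show ?thesis
      using C j by force
  qed (use C in auto)
qed

text \<open>Stanley's transfer map carries \<open>a\<close> to its heights; a monotone reparametrisation \<open>F\<close> of the
  heights, pulled back along the transfer map, stays in the chain polytope.\<close>
lemma reparametrised_in_chain_polytope:
  fixes F :: "real \<Rightarrow> real"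
  assumes a: "a \<in> chain_polytope r" and F: "mono_on {0..1} F" "F 0 = 0" "F 1 = 1"
  shows "(\<chi> i. F (height a (below i)) - F (height a (strictly_below i))) \<in> chain_polytope r"
    (is "?b \<in> _")
proof -
  have Fle: "F (height a U) \<le> F (height a V)" if "U \<subseteq> V" for U V
    using F(1) height_nonneg height_le_1[OF a] height_mono[OF that]
    by (auto intro: mono_onD)
  \<comment> \<open>The sum telescopes: with the top \<open>m\<close> removed, the rest of the chain
    is bounded by \<open>F\<close> at the height strictly below \<open>m\<close>, and the term at
    \<open>m\<close> raises this to \<open>F\<close> at the height of \<open>below m\<close>.
    \<open>U\<close> is a down-set so that it contains \<open>below m\<close>.\<close>
  have bound: "(\<Sum>i\<in>C. ?b $ i) \<le> F (height a U)" if "C \<in> Chains r" "C \<subseteq> U" "down_set U" for C U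
    using that
  proof (induction "card C" arbitrary: C U rule: less_induct)
    case less
    show ?case
    proof (cases "C = {}")
      case True
      have "F 0 \<le> F (height a U)"
        using F(1) height_nonneg height_le_1[OF a] by (auto intro: mono_onD)
      with True F show ?thesis by simp
    next
      case False
      then obtain m where m: "m \<in> C" "\<And>x. x \<in> C \<Longrightarrow> x \<sqsubseteq> m"
        using chain_has_top less by blast
      have "(\<Sum>i\<in>C. ?b $ i) = (\<Sum>i\<in>C - {m}. ?b $ i) + ?b $ m"
        using m by (simp add: sum.remove[of C m])
      also have "(\<Sum>i\<in>C - {m}. ?b $ i) \<le> F (height a (strictly_below m))"
      proof (rule less.hyps)
        show "card (C - {m}) < card C"
          using m(1) by (simp only: card_Diff1_less finite)
      qed (use m less.prems in \<open>auto simp: in_Chains_iff down_set_def intro: le_trans dest: le_antisym\<close>)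
      also have "F (height a (strictly_below m)) + ?b $ m = F (height a (below m))"
        by simp
      also have "\<dots> \<le> F (height a U)"
        by (rule Fle) (use m less.prems in \<open>auto simp: down_set_def\<close>)
      finally show ?thesis by simp
    qed
  qed
  have "(\<Sum>i\<in>C. ?b $ i) \<le> 1" if "C \<in> Chains r" for C
  proof -
    have "(\<Sum>i\<in>C. ?b $ i) \<le> F (height a UNIV)"
      by (rule bound) (use that in \<open>auto simp: down_set_def\<close>)
    also have "\<dots> \<le> F 1"
      using F(1) height_nonneg height_le_1[OF a] by (auto intro: mono_onD)
    finally show ?thesis
      using F by simp
  qed
  then show ?thesis
    using Fle[of "strictly_below _" "below _"] by (auto simp: in_chain_polytope_iff)
qed

text \<open>Reparametrising the heights by \<open>t\<^sup>2\<close> and by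
  \<open>1 - (1 - t)\<^sup>2\<close> gives two points with midpoint \<open>a\<close>. Extremality
  forces both to equal \<open>a\<close>, so at each element either \<open>h i = h' i\<close> or
  \<open>h i + h' i = 1\<close>; upwards through the poset this leaves only the heights 0 and
  1.\<close>

lemma extreme_point_of_chain_polytope:
  assumes a: "a extreme_point_of chain_polytope r"
  obtains A where "a = chi A" "antichain A"
proof -
  have aC: "a \<in> chain_polytope r"
    using a by (simp add: extreme_point_of_def)
  define h h' where "h i = height a (below i)" and "h' i = height a (strictly_below i)" for i
  have ha: "a $ i = h i - h' i" for i
    using height_below[OF aC, of i] by (simp add: h_def h'_def)
  have "(\<chi> i. (h i)\<^sup>2 - (h' i)\<^sup>2) \<in> chain_polytope r"
    unfolding h_def h'_def
    by (rule reparametrised_in_chain_polytope[OF aC]) (auto intro!: mono_onI power_mono)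
  moreover have "(\<chi> i. (1 - (1 - h i)\<^sup>2) - (1 - (1 - h' i)\<^sup>2)) \<in> chain_polytope r"
    unfolding h_def h'_def
    by (rule reparametrised_in_chain_polytope[OF aC]) (auto intro!: mono_onI power_mono)
  moreover have "(\<chi> i. (h i)\<^sup>2 - (h' i)\<^sup>2) + (\<chi> i. (1 - (1 - h i)\<^sup>2) - (1 - (1 - h' i)\<^sup>2)) = a + a"
    by (simp add: vec_eq_iff ha power2_eq_square algebra_simps)
  ultimately have "(\<chi> i. (h i)\<^sup>2 - (h' i)\<^sup>2) = a"
    using extreme_point_ofD_sum[OF a] by blast
  then have "(h i)\<^sup>2 - (h' i)\<^sup>2 = h i - h' i" for i
    by (auto simp: vec_eq_iff ha)
  then have prod: "(h i - h' i) * (h i + h' i - 1) = 0" for i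
    by (simp add: power2_eq_square algebra_simps)
  have step: "h i = h' i \<or> h i = 1 - h' i" for i
    using prod[of i] unfolding mult_eq_0_iff by linarith
  \<comment> \<open>At a minimal counterexample \<open>m\<close>, \<open>h' m\<close> is 0 or the
    height of some element strictly below \<open>m\<close>, so it is 0 or 1, and \<open>step\<close>
    passes this to \<open>h m\<close>.\<close>
  have h01: "h i \<in> {0, 1}" for i
  proof (rule ccontr)
    assume "h i \<notin> {0, 1}"
    then have "i \<in> {i. h i \<notin> {0, 1}}"
      by simp
    then obtain m where m: "m \<in> minimals {i. h i \<notin> {0, 1}}"
      by (rule ex_minimal_below)
    then have "h j \<in> {0, 1}" if "j \<in> strictly_below m" for j
      using that by (auto simp: minimals_def)
    then have "h' m \<in> {0, 1}"
      using height_strictly_below[of a m] unfolding h'_def h_def by force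
    then have "h m \<in> {0, 1}"
      using step[of m] by auto
    then show False
      using m by (auto simp: minimals_def)
  qed
  have "a $ i = 0 \<or> a $ i = 1" for i
  proof -
    have "0 \<le> a $ i"
      using aC by (simp add: in_chain_polytope_iff)
    then show ?thesis
      using h01[of i] step[of i] ha[of i] by auto
  qed
  then have "a = chi {i. a $ i = 1}"
    by (auto simp: vec_eq_iff)
  then show thesis
    using that aC chi_in_chain_polytope_iff by metis
qed

text \<open>The last condition chooses one orientation of the unordered pair, with
  \<open>A - B\<close> as the lower part; it holds vacuously for
  \<open>A \<subset> B\<close>.\<close>

definition chain_edges :: "('n set \<times> 'n set) set" where
  "chain_edges = {(A, B). antichain A \<and> antichain B \<and> connected_in ((A - B) \<union> (B - A)) \<and>
     (\<forall>a\<in>A - B. \<exists>b\<in>B - A. a \<sqsubseteq> b)}"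

text \<open>Tight on the segment are the bounds 1 on \<open>A \<inter> B\<close> and 0 outside
  \<open>A \<union> B\<close>, and the bound 1 on the sum over any comparable pair across the two
  differences. Connectedness then leaves one free parameter.\<close>

lemma segment_face_of_chain_polytope:
  assumes A: "antichain A" and B: "antichain B" and conn: "connected_in ((A - B) \<union> (B - A))"
  shows "closed_segment (chi A) (chi B) face_of chain_polytope r"
proof (rule closed_segment_face_ofI)
  show "chi A \<in> chain_polytope r" "chi B \<in> chain_polytope r"
    using A B by (auto simp: chi_in_chain_polytope_iff)
  fix x u v t
  assume x: "x \<in> closed_segment (chi A) (chi B)" and u: "u \<in> chain_polytope r"
    and v: "v \<in> chain_polytope r" and t: "0 < t" "t < (1::real)" "x = (1 - t) *\<^sub>R u + t *\<^sub>R v"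
  obtain s where s: "x = (1 - s) *\<^sub>R chi A + s *\<^sub>R chi B"
    using x by (auto simp: in_segment)
  have xs: "(1 - t) * u $ i + t * v $ i = (1 - s) * of_bool (i \<in> A) + s * of_bool (i \<in> B)" for i
    using arg_cong[OF trans[OF t(3)[symmetric] s], of "\<lambda>x. x $ i"] by simp
  have uv: "0 \<le> u $ i" "u $ i \<le> 1" "0 \<le> v $ i" "v $ i \<le> 1" for i
    using u v chain_polytope_le_1 by (auto simp: in_chain_polytope_iff)
  have u1: "u $ i = 1" if "i \<in> A \<inter> B" for i
    by (rule convex_combination_eq_upper[OF t(1,2), of _ _ "v $ i"])
      (use xs[of i] uv that in auto)
  have u0: "u $ i = 0" if "i \<notin> A \<union> B" for i
    by (rule convex_combination_eq_lower[OF t(1,2), of _ _ "v $ i"])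
      (use xs[of i] uv that in auto)
  have pair: "u $ i + u $ j = 1"
    if ij: "i \<in> A - B" "j \<in> B - A" "i \<sqsubseteq> j \<or> j \<sqsubseteq> i" for i j
  proof (rule convex_combination_eq_upper[OF t(1,2), of _ _ "v $ i + v $ j"])
    have "w $ i + w $ j \<le> 1" if "w \<in> chain_polytope r" for w
      using ij chain_polytope_pair_le_1[OF that, of i j] chain_polytope_pair_le_1[OF that, of j i]
      by (auto simp: add.commute)
    with u v show "u $ i + u $ j \<le> 1" "v $ i + v $ j \<le> 1"
      by auto
    show "(1 - t) * (u $ i + u $ j) + t * (v $ i + v $ j) = 1"
      using xs[of i] xs[of j] ij by (simp add: algebra_simps)
  qed
  \<comment> \<open>Reflecting the coordinates outside \<open>B\<close> turns the relation
    \<open>u $ i + u $ j = 1\<close> into equality of \<open>f\<close>.\<close>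
  define f where "f i = (if i \<in> B then u $ i else 1 - u $ i)" for i
  have "f i = f j" if ij: "i \<in> (A - B) \<union> (B - A)" "j \<in> (A - B) \<union> (B - A)" "i \<sqsubseteq> j" for i j
  proof -
    consider "i = j" | "i \<in> A - B" "j \<in> B - A" | "i \<in> B - A" "j \<in> A - B"
      using ij A B unfolding antichain_def by blast
    then show ?thesis
      by cases (use ij pair[of i j] pair[of j i] in \<open>auto simp: f_def\<close>)
  qed
  then have "\<exists>q\<in>(A - B) \<union> (B - A). \<forall>i\<in>(A - B) \<union> (B - A). f i = f q"
    by (rule connected_in_const[OF conn])
  then obtain q where q: "\<And>i. i \<in> (A - B) \<union> (B - A) \<Longrightarrow> f i = f q"
    by meson
  have f01: "0 \<le> f q" "f q \<le> 1"
    using uv by (auto simp: f_def)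
  have "u $ i = (1 - f q) * of_bool (i \<in> A) + f q * of_bool (i \<in> B)" for i
    using u0[of i] u1[of i] q[of i] by (auto simp: f_def[of i])
  then have "u = (1 - f q) *\<^sub>R chi A + f q *\<^sub>R chi B"
    by (simp add: vec_eq_iff)
  then show "u \<in> closed_segment (chi A) (chi B)"
    using f01 by (auto simp: in_segment)
qed (rule convex_chain_polytope)

text \<open>Swapping \<open>A\<close> and \<open>B\<close> on an uncrossed cut \<open>X\<close>
  gives antichains \<open>C\<close> and \<open>D\<close> with the same sum of indicators, and
  \<open>C\<close> differs from both \<open>A\<close> and \<open>B\<close>.\<close>

lemma connected_in_of_chain_face:
  assumes face: "closed_segment (chi A) (chi B) face_of chain_polytope r"
    and "A \<noteq> B" and A: "antichain A" and B: "antichain B"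
  shows "connected_in ((A - B) \<union> (B - A))" (is "connected_in ?Q")
  unfolding connected_in_def
proof (intro conjI allI impI)
  show "?Q \<noteq> {}"
    using \<open>A \<noteq> B\<close> by auto
  fix X assume X: "X \<subseteq> ?Q" "X \<noteq> {}" "X \<noteq> ?Q"
  show "\<exists>x\<in>X. \<exists>y\<in>?Q - X. x \<sqsubseteq> y \<or> y \<sqsubseteq> x"
  proof (rule ccontr)
    assume neg: "\<not> ?thesis"
    define C where "C = (A - X) \<union> (B \<inter> X)"
    define D where "D = (B - X) \<union> (A \<inter> X)"
    have "antichain C" "antichain D"
      using A B neg X unfolding antichain_def C_def D_def by blast+
    moreover have "chi C + chi D = chi A + chi B"
      using X by (auto simp: C_def D_def vec_eq_iff)
    ultimately have "C = A \<or> C = B"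
      using face_exchange[OF face] by (auto simp: chi_in_chain_polytope_iff)
    then show False
      using X unfolding C_def by blast
  qed
qed

text \<open>The predicate \<open>f\<close> (\<open>x\<close> is comparable to the other antichain in the direction required by
  \<open>(A, B) \<in> chain_edges\<close>) is constant on the connected symmetric difference.\<close>
lemma chain_edge_orientation:
  assumes A: "antichain A" and B: "antichain B" and conn: "connected_in ((A - B) \<union> (B - A))"
  shows "(A, B) \<in> chain_edges \<or> (B, A) \<in> chain_edges"
proof -
  define f where
    "f x \<longleftrightarrow> (if x \<in> A then \<exists>b\<in>B - A. x \<sqsubseteq> b else \<exists>a\<in>A - B. a \<sqsubseteq> x)" for x
  have "f x = f y" if xy: "x \<in> (A - B) \<union> (B - A)" "y \<in> (A - B) \<union> (B - A)" "x \<sqsubseteq> y" for x y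
  proof -
    consider "x = y" | "x \<in> A - B" "y \<in> B - A" | "x \<in> B - A" "y \<in> A - B"
      using xy A B unfolding antichain_def by blast
    then show ?thesis
    proof cases
      case 2
      then have "f x" "f y"
        using xy by (auto simp: f_def)
      then show ?thesis by simp
    next
      case 3
      \<comment> \<open>An element \<open>a\<close> of \<open>A\<close> below \<open>x\<close> would
        satisfy \<open>a \<sqsubseteq> x \<sqsubseteq> y\<close> with \<open>y\<close> in
        \<open>A\<close>, forcing \<open>a = y = x\<close>. The argument for \<open>y\<close> is
        dual.\<close>
      have "\<not> f x"
      proof
        assume "f x"
        then obtain a where a: "a \<in> A - B" "a \<sqsubseteq> x"
          using 3 by (auto simp: f_def)
        then have "a = y"
          using 3 A le_trans[OF a(2) xy(3)] by (auto simp: antichain_def)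
        then show False
          using 3 a xy le_antisym[of x y] by auto
      qed
      moreover have "\<not> f y"
      proof
        assume "f y"
        then obtain b where b: "b \<in> B - A" "y \<sqsubseteq> b"
          using 3 by (auto simp: f_def)
        then have "b = x"
          using 3 B le_trans[OF xy(3) b(2)] by (auto simp: antichain_def)
        then show False
          using 3 b xy le_antisym[of x y] by auto
      qed
      ultimately show ?thesis by simp
    qed simp
  qed
  then have "\<exists>q\<in>(A - B) \<union> (B - A). \<forall>x\<in>(A - B) \<union> (B - A). f x = f q"
    by (rule connected_in_const[OF conn])
  then obtain q where q: "\<And>x. x \<in> (A - B) \<union> (B - A) \<Longrightarrow> f x = f q"
    by meson
  have "(B, A) \<in> chain_edges" if nAB: "(A, B) \<notin> chain_edges"
  proof -
    obtain a where a: "a \<in> A - B" "\<not> (\<exists>b\<in>B - A. a \<sqsubseteq> b)"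
      using nAB A B conn by (auto simp: chain_edges_def)
    then have nf: "\<not> f x" if "x \<in> (A - B) \<union> (B - A)" for x
      using q[of a] q[OF that] by (auto simp: f_def)
    have "\<exists>a\<in>A - B. b \<sqsubseteq> a" if b: "b \<in> B - A" for b
    proof -
      \<comment> \<open>Since \<open>a\<close> also lies in the symmetric difference, connectedness
        gives \<open>b\<close> a comparable neighbour. It belongs to \<open>A - B\<close>, and since
        \<open>f\<close> fails at \<open>b\<close> it lies above \<open>b\<close>.\<close>
      have "\<exists>x\<in>{b}. \<exists>y\<in>((A - B) \<union> (B - A)) - {b}. x \<sqsubseteq> y \<or> y \<sqsubseteq> x"
      proof -
        have "{b} \<subseteq> (A - B) \<union> (B - A)" "{b} \<noteq> {}" "{b} \<noteq> (A - B) \<union> (B - A)"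
          using a b by auto
        then show ?thesis
          using conn unfolding connected_in_def by blast
      qed
      then obtain y where y: "y \<in> (A - B) \<union> (B - A)" "y \<noteq> b" "b \<sqsubseteq> y \<or> y \<sqsubseteq> b"
        by blast
      then have "y \<in> A - B"
        using b B by (auto simp: antichain_def)
      then show ?thesis
        using y b nf[of b] by (auto simp: f_def)
    qed
    moreover have "connected_in ((B - A) \<union> (A - B))"
      using conn by (simp add: Un_commute)
    ultimately show ?thesis
      using A B by (auto simp: chain_edges_def)
  qed
  then show ?thesis by blast
qed

text \<open>Otherwise some \<open>a\<close> in \<open>A - B\<close> lies below some \<open>b\<close>
  in \<open>B - A\<close>, which in turn lies below some \<open>a'\<close> in \<open>A\<close>; the
  antichain \<open>A\<close> collapses these three.\<close>

lemma chain_edges_asym: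
  assumes AB: "(A, B) \<in> chain_edges"
  shows "(B, A) \<notin> chain_edges"
proof
  assume BA: "(B, A) \<in> chain_edges"
  have up: "\<exists>b\<in>B - A. a \<sqsubseteq> b" if "a \<in> A - B" for a
    using AB that by (auto simp: chain_edges_def)
  have down: "\<exists>a\<in>A - B. b \<sqsubseteq> a" if "b \<in> B - A" for b
    using BA that by (auto simp: chain_edges_def)
  have A: "antichain A"
    using AB by (auto simp: chain_edges_def)
  have "(A - B) \<union> (B - A) \<noteq> {}"
    using AB by (auto simp: chain_edges_def connected_in_def)
  then obtain a where a: "a \<in> A - B"
    using down by blast
  obtain b where b: "b \<in> B - A" "a \<sqsubseteq> b"
    using up a by blast
  obtain a' where a': "a' \<in> A - B" "b \<sqsubseteq> a'"
    using down b by blast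
  have "a = a'"
    using A a a' b le_trans[of a b a'] by (auto simp: antichain_def)
  then show False
    using a b a' le_antisym[of a b] by auto
qed

lemma bij_betw_chain_edges:
  "bij_betw (\<lambda>(A, B). closed_segment (chi A) (chi B)) chain_edges {e. e edge_of chain_polytope r}"
  unfolding bij_betw_def
proof
  show "inj_on (\<lambda>(A, B). closed_segment (chi A) (chi B)) chain_edges"
    using chain_edges_asym by (force simp: inj_on_def doubleton_eq_iff)
  show "(\<lambda>(A, B). closed_segment (chi A) (chi B)) ` chain_edges = {e. e edge_of chain_polytope r}"
  proof (intro equalityI subsetI)
    fix e assume "e \<in> (\<lambda>(A, B). closed_segment (chi A) (chi B)) ` chain_edges"
    then obtain A B where e: "e = closed_segment (chi A) (chi B)" and AB: "(A, B) \<in> chain_edges"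
      by auto
    then have "e face_of chain_polytope r"
      using segment_face_of_chain_polytope by (auto simp: chain_edges_def)
    moreover have "chi A \<noteq> chi B"
      using AB by (auto simp: chain_edges_def connected_in_def)
    ultimately show "e \<in> {e. e edge_of chain_polytope r}"
      using e edge_of_compact_iff[OF compact_chain_polytope convex_chain_polytope] by blast
  next
    fix e assume "e \<in> {e. e edge_of chain_polytope r}"
    then obtain a b where ab: "a \<noteq> b" "e = closed_segment a b" "e face_of chain_polytope r"
      using edge_of_compact_iff[OF compact_chain_polytope convex_chain_polytope] by auto
    obtain A where A: "a = chi A" "antichain A"
      using extreme_point_of_chain_polytope segment_face_of(1) ab by metis
    obtain B where B: "b = chi B" "antichain B"
      using extreme_point_of_chain_polytope segment_face_of(2) ab by metis
    have "connected_in ((A - B) \<union> (B - A))"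
      by (rule connected_in_of_chain_face) (use ab A B in auto)
    then have "(A, B) \<in> chain_edges \<or> (B, A) \<in> chain_edges"
      using A B chain_edge_orientation by blast
    then show "e \<in> (\<lambda>(A, B). closed_segment (chi A) (chi B)) ` chain_edges"
    proof
      assume "(A, B) \<in> chain_edges"
      then show ?thesis
        by (rule rev_image_eqI) (simp add: ab A B)
    next
      assume "(B, A) \<in> chain_edges"
      then show ?thesis
        by (rule rev_image_eqI) (simp add: ab A B insert_commute)
    qed
  qed
qed

subsection \<open>The bijection\<close>

text \<open>An element both minimal and maximal in \<open>J - I\<close> is comparable to no other
  element there, so for connected \<open>J - I\<close> the second subtraction takes effect only on a
  singleton.\<close>

definition chain_edge_of :: "'n set \<times> 'n set \<Rightarrow> 'n set \<times> 'n set" where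
  "chain_edge_of = (\<lambda>(I, J).
     ((maximals J - maximals (J - I)) \<union> (minimals (J - I) - maximals (J - I)), maximals J))"

definition down_closure :: "'n set \<Rightarrow> 'n set" where
  "down_closure B = {x. \<exists>b\<in>B. x \<sqsubseteq> b}"

text \<open>The disjunct \<open>x \<in> B - A\<close> matters only for \<open>A \<subset> B\<close>, when \<open>B - A\<close> is a singleton.\<close>
definition interval_hull :: "'n set \<Rightarrow> 'n set \<Rightarrow> 'n set" where
  "interval_hull A B = {x. (\<exists>b\<in>B - A. x \<sqsubseteq> b) \<and> (x \<in> B - A \<or> (\<exists>a\<in>A - B. a \<sqsubseteq> x))}"

definition order_edge_of :: "'n set \<times> 'n set \<Rightarrow> 'n set \<times> 'n set" where
  "order_edge_of = (\<lambda>(A, B). (down_closure B - interval_hull A B, down_closure B))"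

text \<open>One half of the standard correspondence between down-sets and antichains, which matches
  the vertices of the two polytopes.\<close>

lemma down_closure_maximals:
  assumes "down_set J"
  shows "down_closure (maximals J) = J"
proof (intro equalityI subsetI)
  fix x assume "x \<in> down_closure (maximals J)"
  then show "x \<in> J"
    using assms unfolding down_closure_def maximals_def down_set_def by blast
next
  fix x assume "x \<in> J"
  then obtain m where "m \<in> maximals J" "x \<sqsubseteq> m"
    by (rule ex_maximal_above)
  then show "x \<in> down_closure (maximals J)"
    by (auto simp: down_closure_def)
qed

lemma maximals_down_closure:
  assumes "antichain B"
  shows "maximals (down_closure B) = B"
proof (intro equalityI subsetI)
  fix x assume x: "x \<in> maximals (down_closure B)"
  then obtain b where b: "b \<in> B" "x \<sqsubseteq> b"
    by (auto simp: maximals_def down_closure_def)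
  then have "b \<in> down_closure B"
    using le_refl unfolding down_closure_def by blast
  then show "x \<in> B"
    using x b by (auto simp: maximals_def)
next
  fix x assume x: "x \<in> B"
  then have "x \<in> down_closure B"
    using le_refl unfolding down_closure_def by blast
  moreover have "y = x" if y: "y \<in> down_closure B" "x \<sqsubseteq> y" for y
  proof -
    obtain b where b: "b \<in> B" "y \<sqsubseteq> b"
      using y by (auto simp: down_closure_def)
    then have "x = b"
      using x y assms le_trans[of x y b] by (auto simp: antichain_def)
    then show ?thesis
      using b y le_antisym by blast
  qed
  ultimately show "x \<in> maximals (down_closure B)"
    by (auto simp: maximals_def)
qed

section \<open>From edges of the order polytope to edges of the chain polytope\<close>

context
  fixes I J :: "'n set"
  assumes IJ: "(I, J) \<in> order_edges"
begin

text \<open>Nothing of the down-set \<open>I\<close> lies above an element outside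
  \<open>I\<close>.\<close>

lemma maximals_diff_subset: "maximals (J - I) \<subseteq> maximals J"
  using IJ by (auto simp: maximals_def order_edges_def down_set_def)

lemma chain_edge_of_diffs:
  assumes "chain_edge_of (I, J) = (A, B)"
  shows "B - A = maximals (J - I)" "A - B = minimals (J - I) - maximals (J - I)"
proof -
  have "minimals (J - I) \<inter> maximals J \<subseteq> maximals (J - I)"
    by (auto simp: minimals_def maximals_def)
  with assms maximals_diff_subset
  show "B - A = maximals (J - I)" "A - B = minimals (J - I) - maximals (J - I)"
    by (auto simp: chain_edge_of_def)
qed

lemma chain_edge_of_in_chain_edges: "chain_edge_of (I, J) \<in> chain_edges"
proof -
  obtain A B where AB: "chain_edge_of (I, J) = (A, B)"
    by fastforce
  note diffs = chain_edge_of_diffs[OF AB]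
  have A: "A = (maximals J - maximals (J - I)) \<union> (minimals (J - I) - maximals (J - I))"
    and B: "B = maximals J"
    using AB by (auto simp: chain_edge_of_def)
  have down: "down_set I"
    using IJ by (auto simp: order_edges_def)
  have max_I: "x \<in> I" if "x \<in> maximals J - maximals (J - I)" for x
    using that by (auto simp: maximals_def)
  have "antichain B"
    by (auto simp: B antichain_def maximals_def)
  moreover have "antichain A"
    unfolding antichain_def
  proof (intro ballI impI)
    fix x y assume xy: "x \<in> A" "y \<in> A" "x \<sqsubseteq> y"
    have "y \<in> J"
      using xy by (auto simp: A minimals_def maximals_def)
    \<comment> \<open>The second case is contradictory: the down-set \<open>I\<close> would contain
      \<open>x\<close>.\<close>
    consider "x \<in> maximals J" | "x \<in> minimals (J - I)" "y \<in> I" | "x \<in> minimals (J - I)" "y \<in> minimals (J - I)"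
      using xy max_I by (auto simp: A)
    then show "x = y"
    proof cases
      case 1
      then show ?thesis
        using \<open>y \<in> J\<close> xy by (auto simp: maximals_def)
    next
      case 2
      then show ?thesis
        using down xy by (auto simp: minimals_def down_set_def)
    next
      case 3
      then show ?thesis
        using xy by (auto simp: minimals_def)
    qed
  qed
  moreover have "connected_in ((A - B) \<union> (B - A))"
  proof -
    have "(A - B) \<union> (B - A) = minimals (J - I) \<union> maximals (J - I)"
      using diffs by auto
    then show ?thesis
      using IJ connected_in_extremals_iff by (auto simp: order_edges_def)
  qed
  moreover have "\<exists>b\<in>B - A. a \<sqsubseteq> b" if "a \<in> A - B" for a
  proof -
    have "a \<in> J - I"
      using that diffs by (auto simp: minimals_def)
    then show ?thesis
      using ex_maximal_above diffs by metis
  qed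
  ultimately show ?thesis
    by (auto simp: AB chain_edges_def)
qed

text \<open>A difference of down-sets contains everything between two of its elements, so it is
  recovered from its minimal and maximal elements.\<close>

lemma order_edge_of_chain_edge_of: "order_edge_of (chain_edge_of (I, J)) = (I, J)"
proof -
  obtain A B where AB: "chain_edge_of (I, J) = (A, B)"
    by fastforce
  note diffs = chain_edge_of_diffs[OF AB]
  have down: "down_set I" "down_set J" "I \<subset> J"
    using IJ by (auto simp: order_edges_def)
  have "interval_hull A B = J - I"
  proof (intro equalityI subsetI)
    fix x assume "x \<in> interval_hull A B"
    then obtain b where "b \<in> maximals (J - I)" "x \<sqsubseteq> b"
      "x \<in> maximals (J - I) \<or> (\<exists>a\<in>minimals (J - I). a \<sqsubseteq> x)"
      unfolding interval_hull_def diffs by blast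
    then show "x \<in> J - I"
      using down unfolding down_set_def maximals_def minimals_def by blast
  next
    fix x assume x: "x \<in> J - I"
    obtain b where b: "b \<in> maximals (J - I)" "x \<sqsubseteq> b"
      using ex_maximal_above[OF x] .
    obtain a where a: "a \<in> minimals (J - I)" "a \<sqsubseteq> x"
      using ex_minimal_below[OF x] .
    \<comment> \<open>If the chosen minimal element is also maximal, it is missing from
      \<open>A - B\<close>; then \<open>x\<close> itself is in \<open>B - A\<close>.\<close>
    have "x = a" if "a \<in> maximals (J - I)"
      using that a x by (auto simp: maximals_def)
    then show "x \<in> interval_hull A B"
      using a b unfolding interval_hull_def diffs by blast
  qed
  moreover have "down_closure B = J"
    using AB down_closure_maximals[OF down(2)] by (auto simp: chain_edge_of_def)
  ultimately show ?thesis
    using down AB by (auto simp: order_edge_of_def)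
qed

end

section \<open>From edges of the chain polytope back to edges of the order polytope\<close>

context
  fixes A B :: "'n set"
  assumes AB: "(A, B) \<in> chain_edges"
begin

lemma chain_edge_facts:
  shows antichain_A: "antichain A" and antichain_B: "antichain B"
    and connected_sym_diff: "connected_in ((A - B) \<union> (B - A))"
    and ex_upper: "a \<in> A - B \<Longrightarrow> \<exists>b\<in>B - A. a \<sqsubseteq> b"
  using AB by (auto simp: chain_edges_def)

text \<open>Unless \<open>b\<close> is the whole symmetric difference, it has a comparable
  \<open>y\<close> in \<open>A - B\<close>. If \<open>y\<close> were above \<open>b\<close>, the
  element of \<open>B\<close> above \<open>y\<close> would also be above \<open>b\<close>,
  contradicting that \<open>B\<close> is an antichain.\<close>

lemma ex_lower:
  assumes b: "b \<in> B - A"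
  shows "B - A = {b} \<and> A - B = {} \<or> (\<exists>a\<in>A - B. a \<sqsubseteq> b)"
proof (cases "(A - B) \<union> (B - A) = {b}")
  case False
  have "{b} \<subseteq> (A - B) \<union> (B - A)" "{b} \<noteq> {}" "{b} \<noteq> (A - B) \<union> (B - A)"
    using b False by auto
  then have "\<exists>x\<in>{b}. \<exists>y\<in>((A - B) \<union> (B - A)) - {b}. x \<sqsubseteq> y \<or> y \<sqsubseteq> x"
    using connected_sym_diff unfolding connected_in_def by blast
  then obtain y where y: "y \<in> (A - B) \<union> (B - A)" "y \<noteq> b" "b \<sqsubseteq> y \<or> y \<sqsubseteq> b"
    by blast
  then have yA: "y \<in> A - B"
    using b antichain_B by (auto simp: antichain_def)
  then obtain b' where "b' \<in> B - A" "y \<sqsubseteq> b'"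
    using ex_upper by blast
  then have "\<not> b \<sqsubseteq> y"
    using b antichain_B yA le_trans[of b y b'] le_antisym[of b y] by (auto simp: antichain_def)
  then show ?thesis
    using y yA by blast
qed (use b in auto)

lemma maximals_interval_hull: "maximals (interval_hull A B) = B - A"
proof (intro equalityI subsetI)
  fix x assume x: "x \<in> maximals (interval_hull A B)"
  then obtain b where "b \<in> B - A" "x \<sqsubseteq> b"
    by (auto simp: maximals_def interval_hull_def)
  moreover from this have "b \<in> interval_hull A B"
    using le_refl unfolding interval_hull_def by blast
  ultimately show "x \<in> B - A"
    using x by (auto simp: maximals_def)
next
  fix x assume x: "x \<in> B - A"
  then have "x \<in> interval_hull A B"
    using le_refl unfolding interval_hull_def by blast
  moreover have "y = x" if y: "y \<in> interval_hull A B" "x \<sqsubseteq> y" for y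
  proof -
    obtain b where b: "b \<in> B - A" "y \<sqsubseteq> b"
      using y by (auto simp: interval_hull_def)
    then have "x = b"
      using x y antichain_B le_trans[of x y b] by (auto simp: antichain_def)
    then show ?thesis
      using b y le_antisym by blast
  qed
  ultimately show "x \<in> maximals (interval_hull A B)"
    by (auto simp: maximals_def)
qed

lemma minimals_interval_hull: "minimals (interval_hull A B) - (B - A) = A - B"
proof (intro equalityI subsetI)
  fix x assume x: "x \<in> minimals (interval_hull A B) - (B - A)"
  then obtain a where a: "a \<in> A - B" "a \<sqsubseteq> x"
    by (auto simp: minimals_def interval_hull_def)
  then have "a \<in> interval_hull A B"
    using ex_upper le_refl unfolding interval_hull_def by blast
  then show "x \<in> A - B"
    using a x by (auto simp: minimals_def)
next
  fix x assume x: "x \<in> A - B"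
  then have "x \<in> interval_hull A B"
    using ex_upper le_refl unfolding interval_hull_def by blast
  moreover have "y = x" if y: "y \<in> interval_hull A B" "y \<sqsubseteq> x" for y
  proof -
    \<comment> \<open>For \<open>y\<close> in \<open>B - A\<close> this is \<open>ex_lower\<close>,
      whose singleton alternative is excluded by \<open>x\<close> in \<open>A - B\<close>.\<close>
    have "\<exists>a\<in>A - B. a \<sqsubseteq> y"
      using y ex_lower[of y] x unfolding interval_hull_def by blast
    then obtain a where a: "a \<in> A - B" "a \<sqsubseteq> y"
      by blast
    then have "a = x"
      using x y antichain_A le_trans[of a y x] by (auto simp: antichain_def)
    then show ?thesis
      using a y le_antisym by blast
  qed
  ultimately show "x \<in> minimals (interval_hull A B) - (B - A)"
    using x by (auto simp: minimals_def)
qed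

lemma interval_hull_subset: "interval_hull A B \<subseteq> down_closure B"
  by (auto simp: interval_hull_def down_closure_def)

lemma order_edge_of_in_order_edges: "order_edge_of (A, B) \<in> order_edges"
proof -
  let ?Q = "interval_hull A B" and ?J = "down_closure B"
  have down: "down_set ?J"
    using le_trans by (auto simp: down_set_def down_closure_def)
  \<comment> \<open>Removing the hull leaves a down-set: an element \<open>x\<close> of
    \<open>?J\<close> above some \<open>y\<close> in \<open>?Q\<close> is either equal to
    \<open>y\<close> or squeezed between an element of \<open>A - B\<close> and an element
    \<open>b\<close> of \<open>B\<close>, where \<open>b\<close> is not in \<open>A\<close> because
    \<open>A\<close> is an antichain.\<close>
  have "y \<notin> ?Q" if x: "x \<in> ?J - ?Q" and yx: "y \<sqsubseteq> x" for x y
  proof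
    assume y: "y \<in> ?Q"
    obtain b where b: "b \<in> B" "x \<sqsubseteq> b"
      using x by (auto simp: down_closure_def)
    have yb: "y \<sqsubseteq> b"
      using le_trans yx b by blast
    consider "y \<in> B - A" | a where "a \<in> A - B" "a \<sqsubseteq> y"
      using y by (auto simp: interval_hull_def)
    then show False
    proof cases
      case 1
      then have "y = b"
        using yb b antichain_B by (auto simp: antichain_def)
      then have "x = y"
        using b yx le_antisym by blast
      then show False
        using x y by simp
    next
      case 2
      then have "a \<sqsubseteq> x" "a \<sqsubseteq> b"
        using le_trans yx yb by blast+
      then have "b \<notin> A"
        using 2 b antichain_A by (auto simp: antichain_def)
      then show False
        using x b 2 \<open>a \<sqsubseteq> x\<close> by (auto simp: interval_hull_def)
    qed
  qed
  then have "down_set (?J - ?Q)"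
    using down unfolding down_set_def by blast
  moreover have "?J - (?J - ?Q) = ?Q"
    using interval_hull_subset by blast
  moreover have conn: "connected_in ?Q"
  proof -
    have "minimals ?Q \<union> maximals ?Q = (A - B) \<union> (B - A)"
      using minimals_interval_hull maximals_interval_hull by blast
    then show ?thesis
      using connected_sym_diff connected_in_extremals_iff by metis
  qed
  moreover have "?J - ?Q \<subset> ?J"
    using conn interval_hull_subset unfolding connected_in_def by blast
  ultimately show ?thesis
    using down by (simp add: order_edge_of_def order_edges_def)
qed

lemma chain_edge_of_order_edge_of: "chain_edge_of (order_edge_of (A, B)) = (A, B)"
proof -
  have *: "down_closure B - (down_closure B - interval_hull A B) = interval_hull A B"
    using interval_hull_subset by blast
  show ?thesis
    using antichain_B
    by (auto simp: order_edge_of_def chain_edge_of_def * maximals_interval_hull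
        minimals_interval_hull maximals_down_closure)
qed

end

lemma bij_betw_chain_edge_of: "bij_betw chain_edge_of order_edges chain_edges"
proof (rule bij_betw_byWitness[where f' = order_edge_of])
  show "\<forall>e\<in>order_edges. order_edge_of (chain_edge_of e) = e"
    using order_edge_of_chain_edge_of by auto
  show "\<forall>e\<in>chain_edges. chain_edge_of (order_edge_of e) = e"
    using chain_edge_of_order_edge_of by auto
  show "chain_edge_of ` order_edges \<subseteq> chain_edges"
    using chain_edge_of_in_chain_edges by auto
  show "order_edge_of ` chain_edges \<subseteq> order_edges"
    using order_edge_of_in_order_edges by auto
qed

end

theorem theorem2p1:
  fixes r :: "'n::finite rel"
  assumes "partial_order_on UNIV r"
  shows "card {e. e edge_of order_polytope r} = card {e. e edge_of chain_polytope r}"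
proof -
  interpret finite_poset r
    by (rule finite_poset.intro) (fact assms)
  show ?thesis
    using bij_betw_order_edges bij_betw_chain_edges bij_betw_chain_edge_of
    by (metis bij_betw_same_card)
qed

end
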